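(* Let $K\in\mathbb N$ and let $f_K(\mathbf u)=\sum_{k=1}^K c_k g_k(\mathbf u)$, $\mathbf u\in\mathbb R_+^D$, be a convex function satisfying (F1)–(F4), where $c_k>0$ for each $k\in\{1,\dots,K\}$ and $g_k(\mathbf u)=\prod_{i=1}^D u_i^{\tau_{ki}}$ with $\tau_{ki}\in\mathbb R_+$ for all $k,i$, and $\tau_k:=\sum_{i=1}^D\tau_{ki}$. Let $\tau:=\max_{k}\tau_k$ and assume $\tau\ge 2$. Set $\rho=\tau^{1/(\tau-1)}$ and $f_s(\mathbf u)=\frac1\rho f_K(\rho\mathbf u)$. Then, with procurement cost function $f=f_K$, the Simultaneous Update algorithm called with $f_s$ has competitive ratio at least $\tau^{-\tau/(\tau-1)}$; that is, for all $v_1,\dots,v_T$ satisfying (V1)–(V3), its decisions satisfy $$\sum_{t=1}^T v_t(\bar{\mathbf x}_t)-f_K\Big(\sum_{t=1}^T\bar{\mathbf x}_t\Big)\ \ge\ \tau^{-\tau/(\tau-1)}\,P^\star .$$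
   Context: Fix integers $D,T\ge 1$. Vector inequalities $\succeq,\preceq$ are componentwise; $\mathbf 0,\mathbf 1\in\mathbb R^D$ are the all-zeros and all-ones vectors. A function is closed if its sublevel sets are closed (superlevel sets, for a concave function). The convention $0^0=1$ is used in monomials. Payment functions $v_t:\mathbb R_+^D\to\mathbb R_+$, $t=1,\dots,T$, satisfy: (V1) $v_t$ is concave, differentiable and closed; (V2) $\mathbf u\succeq\mathbf v$ implies $v_t(\mathbf u)\ge v_t(\mathbf v)$; (V3) $v_t(\mathbf 0)=0$. A procurement cost $f:\mathbb R_+^D\to\mathbb R_+$ satisfies: (F1) $f$ is convex, differentiable and closed; (F2) $\mathbf u\succeq\mathbf v$ implies $f(\mathbf u)\ge f(\mathbf v)$; (F3) $\mathbf u\succeq\mathbf v$ implies $\nabla f(\mathbf u)\succeq\nabla f(\mathbf v)$; (F4) $f(\mathbf 0)=0$. Offline optimum (with $f=f_K$): $P^\star:=\max\{\sum_{t=1}^T v_t(\mathbf x_t)-f(\sum_{t=1}^T\mathbf x_t): \mathbf x_t\in[0,1]^D\text{ for all }t\}$. Conjugates: $f_s^*(\boldsymbol\lambda)=\sup_{\mathbf u\in\mathbb R_+^D}\{\boldsymbol\lambda^\top\mathbf u-f_s(\mathbf u)\}$; concave conjugate $v_{t*}(\mathbf z)=\inf_{\mathbf u\in\mathbb R_+^D}\{\mathbf z^\top\mathbf u-v_t(\mathbf u)\}$. Simultaneous Update algorithm called with a surrogate function $f_s$: for $t=1,\dots,T$, after $v_t$ is revealed and given $\bar{\mathbf x}_1,\dots,\bar{\mathbf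 x}_{t-1}$, it takes $(\bar{\boldsymbol\lambda}_t,\bar{\mathbf z}_t,\bar{\mathbf x}_t)$ to be a saddle point of $$\min_{\boldsymbol\lambda\succeq\mathbf 0,\ \mathbf z\succeq\mathbf 0}\ \max_{\mathbf 0\preceq\mathbf x\preceq\mathbf 1}\ \mathbf z^\top\mathbf x-v_{t*}(\mathbf z)-\boldsymbol\lambda^\top\Big(\sum_{i=1}^{t-1}\bar{\mathbf x}_i+\mathbf x\Big)+f_s^*(\boldsymbol\lambda),$$ with $\bar{\boldsymbol\lambda}_t=\nabla f_s(\sum_{i=1}^t\bar{\mathbf x}_i)$ and $\bar{\mathbf z}_t=\nabla v_t(\bar{\mathbf x}_t)$. In particular $\bar{\mathbf x}_t$ maximizes $(\bar{\mathbf z}_t-\bar{\boldsymbol\lambda}_t)^\top\mathbf x$ over $\mathbf 0\preceq\mathbf x\preceq\mathbf 1$. *)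

theory Defs
  imports "HOL-Analysis.Analysis"
begin

text \<open>
  Vectors are elements of \<open>real ^ 'n\<close> with the library's componentwise order, so \<open>{0..}\<close> is
  the nonnegative orthant and \<open>{0..1}\<close> is the unit box, with \<open>1\<close> the all-ones vector.
  Functions on the orthant are total functions whose values off the orthant are irrelevant.
\<close>

text \<open>
  Differentiability and gradients are taken within the orthant, so they also make sense at its
  boundary points, where the algorithm evaluates them. The vector described here is unique
  because each point of the orthant is approached within it along every axis (\<open>grad_eqI\<close>).
\<close>

definition grad :: "(real ^ 'n \<Rightarrow> real) \<Rightarrow> real ^ 'n \<Rightarrow> real ^ 'n" where
  "grad f u = (THE g. (f has_derivative (\<lambda>h. g \<bullet> h)) (at u within {0..}))"

lemma grad_eqI:
  fixes f :: "real ^ 'n \<Rightarrow> real"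
  assumes g: "(f has_derivative (\<lambda>h. g \<bullet> h)) (at u within {0..})" and u: "0 \<le> u"
  shows "grad f u = g"
  unfolding grad_def
proof (rule the_equality, rule g)
  fix g' assume g': "(f has_derivative (\<lambda>h. g' \<bullet> h)) (at u within {0..})"
  have "(\<lambda>h. g' \<bullet> h) = (\<lambda>h. g \<bullet> h)"
  proof (rule frechet_derivative_unique_within[OF g' g])
    fix i :: "real ^ 'n" and e :: real
    assume i: "i \<in> Basis" and "0 < e"
    have "0 \<le> i"
      using i by (auto simp: Basis_vec_def less_eq_vec_def axis_def)
    then have "u + (e / 2) *\<^sub>R i \<in> {0..}"
      using u \<open>0 < e\<close> by (simp add: less_eq_vec_def)
    then show "\<exists>d. 0 < \<bar>d\<bar> \<and> \<bar>d\<bar> < e \<and> u + d *\<^sub>R i \<in> {0..}"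
      using \<open>0 < e\<close> by (intro exI[of _ "e / 2"]) auto
  qed
  then show "g' = g"
    by (metis vector_eq_rdot)
qed

definition payment_function :: "(real ^ 'n \<Rightarrow> real) \<Rightarrow> bool" where
  "payment_function v \<longleftrightarrow>
     (\<forall>u\<in>{0..}. 0 \<le> v u) \<and>
     concave_on {0..} v \<and>
     v differentiable_on {0..} \<and>
     (\<forall>a. closed {u \<in> {0..}. a \<le> v u}) \<and>
     (\<forall>u\<in>{0..}. \<forall>w\<in>{0..}. w \<le> u \<longrightarrow> v w \<le> v u) \<and>
     v 0 = 0"

definition procurement_cost :: "(real ^ 'n \<Rightarrow> real) \<Rightarrow> bool" where
  "procurement_cost f \<longleftrightarrow>
     (\<forall>u\<in>{0..}. 0 \<le> f u) \<and>
     convex_on {0..} f \<and>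
     f differentiable_on {0..} \<and>
     (\<forall>a. closed {u \<in> {0..}. f u \<le> a}) \<and>
     (\<forall>u\<in>{0..}. \<forall>w\<in>{0..}. w \<le> u \<longrightarrow> f w \<le> f u) \<and>
     (\<forall>u\<in>{0..}. \<forall>w\<in>{0..}. w \<le> u \<longrightarrow> grad f w \<le> grad f u) \<and>
     f 0 = 0"

text \<open>The supremum is a maximum for continuous data: see \<open>offline_optimum_is_max\<close>.\<close>

definition offline_optimum ::
    "(real ^ 'n \<Rightarrow> real) \<Rightarrow> (nat \<Rightarrow> real ^ 'n \<Rightarrow> real) \<Rightarrow> nat \<Rightarrow> real" where
  "offline_optimum f v T =
     Sup {(\<Sum>t=1..T. v t (x t)) - f (\<Sum>t=1..T. x t) | x. \<forall>t\<in>{1..T}. x t \<in> {0..1}}"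

lemma offline_optimum_is_max:
  fixes f :: "real ^ 'n \<Rightarrow> real"
  assumes f: "procurement_cost f" and v: "\<And>t. t \<in> {1..T} \<Longrightarrow> payment_function (v t)"
  defines "val \<equiv> \<lambda>x :: nat \<Rightarrow> real ^ 'n. (\<Sum>t=1..T. v t (x t)) - f (\<Sum>t=1..T. x t)"
  shows "\<exists>x. (\<forall>t\<in>{1..T}. x t \<in> {0..1}) \<and> offline_optimum f v T = val x \<and>
             (\<forall>y. (\<forall>t\<in>{1..T}. y t \<in> {0..1}) \<longrightarrow> val y \<le> val x)"
proof -
  define B where "B = PiE UNIV (\<lambda>_::nat. {0..1::real ^ 'n})"
  have "compactin (product_topology (\<lambda>_. euclidean) UNIV) B"
    unfolding B_def compactin_PiE by (simp flip: interval_cbox)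
  then have B: "compact B"
    by (simp add: euclidean_product_topology)
  have vc: "continuous_on {0..} (v t)" if "t \<in> {1..T}" for t
    using v[OF that] differentiable_imp_continuous_on unfolding payment_function_def by blast
  have fc: "continuous_on {0..} f"
    using f differentiable_imp_continuous_on unfolding procurement_cost_def by blast
  have coord: "continuous_on B (\<lambda>x. x t)" for t
    by (rule continuous_on_subset[OF continuous_on_product_coordinates]) simp
  have Bin: "x t \<in> {0..}" if "x \<in> B" for x t
    using that by (auto simp: B_def)
  have c: "continuous_on B val"
    unfolding val_def
  proof (intro continuous_intros)
    fix t assume "t \<in> {1..T}"
    then show "continuous_on B (\<lambda>x. v t (x t))"
      by (intro continuous_on_compose2[OF vc coord]) (auto simp: B_def)
  next
    show "continuous_on B (\<lambda>x. f (\<Sum>t=1..T. x t))"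
      by (rule continuous_on_compose2[OF fc])
         (use Bin in \<open>auto intro!: continuous_on_sum coord sum_nonneg\<close>)
  qed
  have "B \<noteq> {}"
    by (auto simp: B_def PiE_eq_empty_iff less_eq_vec_def)
  then obtain x where x: "x \<in> B" "\<And>y. y \<in> B \<Longrightarrow> val y \<le> val x"
    using continuous_attains_sup[OF B _ c] by blast
  have le: "val y \<le> val x" if y: "\<forall>t\<in>{1..T}. y t \<in> {0..1}" for y
  proof -
    have "val y = val (\<lambda>t. if t \<in> {1..T} then y t else 0)"
      unfolding val_def by (intro arg_cong2[where f="(-)"] arg_cong[where f=f] sum.cong) auto
    also have "\<dots> \<le> val x"
      by (rule x(2)) (use y in \<open>auto simp: B_def less_eq_vec_def\<close>)
    finally show ?thesis .
  qed
  have xb: "\<forall>t\<in>{1..T}. x t \<in> {0..1}"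
    using x(1) by (auto simp: B_def)
  have "offline_optimum f v T = val x"
    unfolding offline_optimum_def
    by (rule cSup_eq_maximum) (use xb le in \<open>auto simp: val_def\<close>)
  with xb le show ?thesis by blast
qed

text \<open>Both conjugates can be infinite, hence the extended reals.\<close>

definition convex_conjugate :: "(real ^ 'n \<Rightarrow> real) \<Rightarrow> real ^ 'n \<Rightarrow> ereal" where
  "convex_conjugate f l = (SUP u\<in>{0..}. ereal (l \<bullet> u - f u))"

definition concave_conjugate :: "(real ^ 'n \<Rightarrow> real) \<Rightarrow> real ^ 'n \<Rightarrow> ereal" where
  "concave_conjugate v z = (INF u\<in>{0..}. ereal (z \<bullet> u - v u))"

definition saddle_point ::
    "'a set \<Rightarrow> 'b set \<Rightarrow> ('a \<Rightarrow> 'b \<Rightarrow> ereal) \<Rightarrow> 'a \<Rightarrow> 'b \<Rightarrow> bool" where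
  "saddle_point A B L a b \<longleftrightarrow>
     a \<in> A \<and> b \<in> B \<and> (\<forall>b'\<in>B. L a b' \<le> L a b) \<and> (\<forall>a'\<in>A. L a b \<le> L a' b)"

text \<open>
  The argument \<open>s\<close> is the sum of the earlier decisions. No \<open>\<infinity> - \<infinity>\<close> arises when
  \<open>v 0 = 0\<close> and \<open>fs 0 = 0\<close>, as then the concave conjugate is at most \<open>0\<close> and the convex one at
  least \<open>0\<close>.
\<close>

definition su_objective ::
    "(real ^ 'n \<Rightarrow> real) \<Rightarrow> (real ^ 'n \<Rightarrow> real) \<Rightarrow> real ^ 'n \<Rightarrow>
     (real ^ 'n) \<times> (real ^ 'n) \<Rightarrow> real ^ 'n \<Rightarrow> ereal" where
  "su_objective fs v s = (\<lambda>(l, z) x.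
     ereal (z \<bullet> x) - concave_conjugate v z - ereal (l \<bullet> (s + x)) + convex_conjugate fs l)"

text \<open>
  The saddle point need not be unique, so a run of the algorithm is a relation between the input
  and the produced sequences \<open>l\<close>, \<open>z\<close> (dual variables) and \<open>x\<close> (decisions).
\<close>

definition simultaneous_update ::
    "(real ^ 'n \<Rightarrow> real) \<Rightarrow> (nat \<Rightarrow> real ^ 'n \<Rightarrow> real) \<Rightarrow> nat \<Rightarrow>
     (nat \<Rightarrow> real ^ 'n) \<Rightarrow> (nat \<Rightarrow> real ^ 'n) \<Rightarrow> (nat \<Rightarrow> real ^ 'n) \<Rightarrow> bool" where
  "simultaneous_update fs v T l z x \<longleftrightarrow>
     (\<forall>t\<in>{1..T}.
        saddle_point ({0..} \<times> {0..}) {0..1} (su_objective fs (v t) (\<Sum>i\<in>{1..<t}. x i))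
          (l t, z t) (x t) \<and>
        l t = grad fs (\<Sum>i=1..t. x i) \<and>
        z t = grad (v t) (x t))"

text \<open>The library has \<open>0 powr 0 = 0\<close>, whereas monomials use the convention \<open>0\<^sup>0 = 1\<close>.\<close>

definition monomial_pow :: "real \<Rightarrow> real \<Rightarrow> real" where
  "monomial_pow a r = (if r = 0 then 1 else a powr r)"

definition monomial_fun :: "real ^ 'n \<Rightarrow> real ^ 'n \<Rightarrow> real" where
  "monomial_fun e u = (\<Prod>i\<in>UNIV. monomial_pow (u $ i) (e $ i))"

end

theory Submission
  imports Defs
begin

text \<open>
  The argument is a primal-dual one. By concavity of the payments and optimality of each decision
  \<open>x t\<close> against the prices \<open>l t = grad fs (\<Sum>i=1..t. x i)\<close>, no other decision \<open>y\<close> has a surplus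
  \<open>v t y - l t \<bullet> y\<close> above \<open>W t = v t (x t) - l t \<bullet> x t\<close>, and \<open>W t \<ge> 0\<close> by taking \<open>y = 0\<close>. Write \<open>u\<close>
  for the total purchase, \<open>l = grad fs u\<close> for the final price, and \<open>W\<close> for the sum of the \<open>W t\<close>.
  As gradients are monotone, prices only rise, so the offline optimum is at most
  \<open>W + (l \<bullet> w - fK w)\<close>, where \<open>w\<close> is the total purchase of an optimal solution. Convexity of \<open>fs\<close>
  shows that the payments collected are at least \<open>W + fs u\<close>, so the algorithm earns at least
  \<open>W + (fs u - fK u)\<close>. A ratio \<open>\<alpha> \<le> 1\<close> therefore follows from the inequality
  \<open>\<alpha> * (grad fs u \<bullet> w - fK w) \<le> fs u - fK u\<close> for all \<open>u\<close> and \<open>w\<close>, which no longer mentions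
  payments (\<open>simultaneous_update_competitive\<close>).

  For \<open>fs u = fK (\<rho> *\<^sub>R u) / \<rho>\<close> the gradient at \<open>u\<close> is that of \<open>fK\<close> at \<open>\<rho> *\<^sub>R u\<close>, so \<open>w = \<rho> *\<^sub>R u\<close> is
  the worst case. Euler's identity then expands both sides in the monomials at \<open>u\<close>, and a monomial of
  degree \<open>s\<close> contributes \<open>\<alpha> * (s - 1) * \<rho> powr s\<close> on the left and \<open>\<rho> powr (s - 1) - 1\<close> on the right.
  With the stated \<open>\<rho>\<close> and \<open>\<alpha>\<close> this is an inequality between weighted means for
  \<open>1 \<le> s \<le> \<tau>\<close>, tight at both ends (\<open>scaled_degree_inequality\<close>). It fails for \<open>s < 1\<close>, but a convex
  cost vanishing at \<open>0\<close> has no terms of such a degree (\<open>convex_monomial_sum_degree_ge_1\<close>).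
\<close>

section \<open>Gradients on the orthant\<close>

lemma grad_has_derivative:
  fixes f :: "real ^ 'n \<Rightarrow> real"
  assumes "f differentiable_on {0..}" and "0 \<le> u"
  shows "(f has_derivative (\<lambda>h. grad f u \<bullet> h)) (at u within {0..})"
proof -
  obtain D where D: "(f has_derivative D) (at u within {0..})"
    using assms by (auto simp: differentiable_on_def differentiable_def)
  then interpret D: bounded_linear D
    by (rule has_derivative_bounded_linear)
  have "D = (\<lambda>h. adjoint D 1 \<bullet> h)"
    using adjoint_works[OF D.linear_axioms, where y=1] by (auto simp: inner_commute)
  with D have "(f has_derivative (\<lambda>h. adjoint D 1 \<bullet> h)) (at u within {0..})"
    by simp
  with grad_eqI[OF this \<open>0 \<le> u\<close>] show ?thesis
    by simp
qed

text \<open>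
  The derivative is only assumed within the set, so that the tangent inequality is available at
  boundary points, where decisions such as \<open>0\<close> lie.
\<close>

lemma convex_on_ge_tangent_within:
  fixes f :: "'a :: real_normed_vector \<Rightarrow> real"
  assumes f: "convex_on A f" and D: "(f has_derivative D) (at u within A)"
    and u: "u \<in> A" and w: "w \<in> A"
  shows "f u + D (w - u) \<le> f w"
proof -
  interpret D: bounded_linear D
    using D by (rule has_derivative_bounded_linear)
  define p where "p = (\<lambda>r::real. u + r *\<^sub>R (w - u))"
  have p_eq: "p r = (1 - r) *\<^sub>R u + r *\<^sub>R w" for r
    by (simp add: p_def algebra_simps)
  have pA: "p ` {0..1} \<subseteq> A"
    using convex_on_imp_convex[OF f] u w by (auto simp: p_eq intro!: convexD)
  have "(p has_derivative (\<lambda>r. r *\<^sub>R (w - u))) (at 0 within {0..1})"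
    unfolding p_def by (auto intro!: derivative_eq_intros)
  moreover have "(f has_derivative D) (at (p 0) within p ` {0..1})"
    using has_derivative_subset[OF D pA] by (simp add: p_def)
  ultimately have "((\<lambda>r. f (p r)) has_derivative (\<lambda>r. D (r *\<^sub>R (w - u)))) (at 0 within {0..1})"
    by (rule has_derivative_in_compose)
  then have "((\<lambda>r. f (p r)) has_real_derivative D (w - u)) (at 0 within {0..1})"
    by (simp add: has_field_derivative_def D.scaleR mult.commute[of _ "D (w - u)"])
  then have lim: "((\<lambda>r. (f (p r) - f u) / r) \<longlongrightarrow> D (w - u)) (at 0 within {0..1})"
    by (simp add: has_field_derivative_iff p_def)
  have "eventually (\<lambda>r. (f (p r) - f u) / r \<le> f w - f u) (at 0 within {0..1})"
    unfolding eventually_at_filter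
  proof (intro always_eventually allI impI)
    fix r :: real assume r: "r \<noteq> 0" "r \<in> {0..1}"
    have "f (p r) \<le> (1 - r) * f u + r * f w"
      unfolding p_eq using convex_onD[OF f _ _ u w, of r] r by simp
    with r show "(f (p r) - f u) / r \<le> f w - f u"
      by (simp add: divide_simps algebra_simps)
  qed
  moreover have "at 0 within {0..1::real} \<noteq> bot"
    by (simp add: at_within_Icc_at_right)
  ultimately have "D (w - u) \<le> f w - f u"
    using tendsto_upperbound[OF lim] by blast
  then show ?thesis by simp
qed

lemma convex_on_ge_grad:
  fixes f :: "real ^ 'n \<Rightarrow> real"
  assumes "convex_on {0..} f" and "f differentiable_on {0..}" and "0 \<le> u" and "0 \<le> w"
  shows "f u + grad f u \<bullet> (w - u) \<le> f w"
  using convex_on_ge_tangent_within[OF assms(1) grad_has_derivative[OF assms(2,3)]] assms(3,4)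
  by simp

lemma concave_on_le_grad:
  fixes v :: "real ^ 'n \<Rightarrow> real"
  assumes "concave_on {0..} v" and "v differentiable_on {0..}" and "0 \<le> u" and "0 \<le> w"
  shows "v w \<le> v u + grad v u \<bullet> (w - u)"
proof -
  have "((\<lambda>u. - v u) has_derivative (\<lambda>h. - (grad v u \<bullet> h))) (at u within {0..})"
    using grad_has_derivative[OF assms(2,3)] by (rule has_derivative_minus)
  from convex_on_ge_tangent_within[OF _ this, of w] show ?thesis
    using assms by (simp add: concave_on_def)
qed

lemma inner_vec_mono_left:
  fixes a b y :: "real ^ 'n"
  assumes "a \<le> b" and "0 \<le> y"
  shows "a \<bullet> y \<le> b \<bullet> y"
  using assms by (auto simp: inner_vec_def less_eq_vec_def intro!: sum_mono mult_right_mono)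

section \<open>The primal-dual criterion\<close>

text \<open>
  At \<open>grad fs u\<close> and \<open>grad v x\<close> the conjugates are attained at \<open>u\<close> and \<open>x\<close>, hence finite, so they
  cancel from the comparison of the objective at two decisions.
\<close>

lemma saddle_point_su_objective_le:
  fixes fs v :: "real ^ 'n \<Rightarrow> real"
  assumes fs: "convex_on {0..} fs" "fs differentiable_on {0..}" and u: "0 \<le> u"
    and v: "concave_on {0..} v" "v differentiable_on {0..}" and x: "0 \<le> x"
    and sp: "saddle_point A {0..1} (su_objective fs v s) (grad fs u, grad v x) x"
    and y: "y \<in> {0..1}"
  shows "grad v x \<bullet> (y - x) \<le> grad fs u \<bullet> (y - x)"
proof -
  define l z where "l = grad fs u" and "z = grad v x"
  have "concave_conjugate v z = ereal (z \<bullet> x - v x)"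
    unfolding concave_conjugate_def
  proof (rule antisym)
    show "(INF u\<in>{0..}. ereal (z \<bullet> u - v u)) \<le> ereal (z \<bullet> x - v x)"
      using x by (intro INF_lower) auto
    show "ereal (z \<bullet> x - v x) \<le> (INF u\<in>{0..}. ereal (z \<bullet> u - v u))"
      using concave_on_le_grad[OF v x] by (intro INF_greatest) (auto simp: z_def algebra_simps)
  qed
  moreover have "convex_conjugate fs l = ereal (l \<bullet> u - fs u)"
    unfolding convex_conjugate_def
  proof (rule antisym)
    show "ereal (l \<bullet> u - fs u) \<le> (SUP u\<in>{0..}. ereal (l \<bullet> u - fs u))"
      using u by (intro SUP_upper) auto
    show "(SUP u\<in>{0..}. ereal (l \<bullet> u - fs u)) \<le> ereal (l \<bullet> u - fs u)"
      using convex_on_ge_grad[OF fs u] by (intro SUP_least) (auto simp: l_def algebra_simps)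
  qed
  moreover have "su_objective fs v s (l, z) y \<le> su_objective fs v s (l, z) x"
    using sp y by (auto simp: saddle_point_def l_def z_def)
  ultimately have "z \<bullet> (y - x) \<le> l \<bullet> (y - x)"
    by (simp add: su_objective_def algebra_simps)
  then show ?thesis by (simp add: l_def z_def)
qed

text \<open>
  Charging each purchase at the price in force after it covers at least the surrogate cost, because
  the gradient at the right end of a step overestimates the increase of a convex function.
\<close>

lemma convex_le_sum_grad_partial_sums:
  fixes fs :: "real ^ 'n \<Rightarrow> real" and x :: "nat \<Rightarrow> real ^ 'n"
  assumes fs: "convex_on {0..} fs" "fs differentiable_on {0..}" "fs 0 = 0"
    and x: "\<And>t. t \<in> {1..n} \<Longrightarrow> 0 \<le> x t"
  shows "fs (\<Sum>t=1..n. x t) \<le> (\<Sum>t=1..n. grad fs (\<Sum>i=1..t. x i) \<bullet> x t)"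
  using x
proof (induction n)
  case 0
  then show ?case using fs(3) by simp
next
  case (Suc n)
  let ?s = "\<Sum>i=1..n. x i"
  have s: "0 \<le> ?s" and x: "0 \<le> x (Suc n)"
    using Suc.prems by (auto intro!: sum_nonneg)
  then have "fs (?s + x (Suc n)) + grad fs (?s + x (Suc n)) \<bullet> (?s - (?s + x (Suc n))) \<le> fs ?s"
    by (intro convex_on_ge_grad[OF fs(1,2)]) auto
  with Suc.IH Suc.prems show ?case
    by (simp add: inner_diff_right inner_add_right)
qed

text \<open>
  The final price \<open>l = grad fs (\<Sum>t. x t)\<close> is a feasible dual solution: prices only rise, so the
  decisions of the benchmark, priced in their own rounds, cost at most what they cost at \<open>l\<close>.
  The offline optimum then exceeds the buyers' surplus by at most the profit \<open>l \<bullet> w - f w\<close> of the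
  best response to \<open>l\<close>, whereas the algorithm keeps all of that surplus plus at least
  \<open>fs u - f u\<close>, with \<open>u = (\<Sum>t. x t)\<close>. The hypothesis on \<open>\<alpha>\<close> compares these last two quantities.
\<close>

theorem simultaneous_update_competitive:
  fixes f fs :: "real ^ 'n \<Rightarrow> real" and v :: "nat \<Rightarrow> real ^ 'n \<Rightarrow> real"
  assumes f: "procurement_cost f"
    and fs: "convex_on {0..} fs" "fs differentiable_on {0..}" "fs 0 = 0"
    and mono: "\<And>u w. 0 \<le> w \<Longrightarrow> w \<le> u \<Longrightarrow> grad fs w \<le> grad fs u"
    and v: "\<And>t. t \<in> {1..T} \<Longrightarrow> payment_function (v t)"
    and su: "simultaneous_update fs v T l z x"
    and \<alpha>: "0 \<le> \<alpha>" "\<alpha> \<le> 1"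
    and key: "\<And>u w. 0 \<le> u \<Longrightarrow> 0 \<le> w \<Longrightarrow> \<alpha> * (grad fs u \<bullet> w - f w) \<le> fs u - f u"
  shows "\<alpha> * offline_optimum f v T \<le> (\<Sum>t=1..T. v t (x t)) - f (\<Sum>t=1..T. x t)"
proof -
  define S where "S = (\<lambda>t. \<Sum>i=1..t. x i)"
  have x01: "x t \<in> {0..1}" if "t \<in> {1..T}" for t
    using su that by (auto simp: simultaneous_update_def saddle_point_def)
  have S0: "0 \<le> S t" if "t \<le> T" for t
    unfolding S_def using that x01 by (intro sum_nonneg) auto
  have S_le: "S t \<le> S T" if "t \<le> T" for t
    unfolding S_def using that x01 by (intro sum_mono2) auto
  have opt: "v t y \<le> v t (x t) + grad fs (S t) \<bullet> (y - x t)"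
    if t: "t \<in> {1..T}" and y: "y \<in> {0..1}" for t y
  proof -
    have vt: "concave_on {0..} (v t)" "v t differentiable_on {0..}"
      using v[OF t] by (auto simp: payment_function_def)
    have x0: "0 \<le> x t" and y0: "0 \<le> y"
      using x01[OF t] y by auto
    have "saddle_point ({0..} \<times> {0..}) {0..1} (su_objective fs (v t) (\<Sum>i\<in>{1..<t}. x i))
        (grad fs (S t), grad (v t) (x t)) (x t)"
      using su t unfolding simultaneous_update_def S_def by metis
    from saddle_point_su_objective_le[OF fs(1,2) S0 vt x0 this y]
    have "grad (v t) (x t) \<bullet> (y - x t) \<le> grad fs (S t) \<bullet> (y - x t)"
      using t by simp
    with concave_on_le_grad[OF vt x0 y0] show ?thesis by linarith
  qed
  define W where "W = (\<Sum>t=1..T. v t (x t) - grad fs (S t) \<bullet> x t)"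
  have W0: "0 \<le> W"
    unfolding W_def
  proof (rule sum_nonneg)
    fix t assume t: "t \<in> {1..T}"
    have "(0 :: real ^ 'n) \<in> {0..1}"
      by (simp add: less_eq_vec_def)
    from opt[OF t this] show "0 \<le> v t (x t) - grad fs (S t) \<bullet> x t"
      using v[OF t] by (simp add: payment_function_def)
  qed
  have alg: "W + (fs (S T) - f (S T)) \<le> (\<Sum>t=1..T. v t (x t)) - f (S T)"
    using convex_le_sum_grad_partial_sums[OF fs, of T x] x01
    by (simp add: W_def S_def sum_subtractf)
  obtain y where y: "\<And>t. t \<in> {1..T} \<Longrightarrow> y t \<in> {0..1}"
    and P: "offline_optimum f v T = (\<Sum>t=1..T. v t (y t)) - f (\<Sum>t=1..T. y t)"
    using offline_optimum_is_max[where f=f and v=v and T=T, OF f v] by blast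
  define Y where "Y = (\<Sum>t=1..T. y t)"
  have Y0: "0 \<le> Y"
    unfolding Y_def using y by (intro sum_nonneg) auto
  have "(\<Sum>t=1..T. v t (y t))
      \<le> (\<Sum>t=1..T. (v t (x t) - grad fs (S t) \<bullet> x t) + grad fs (S T) \<bullet> y t)"
  proof (rule sum_mono)
    fix t assume t: "t \<in> {1..T}"
    have "grad fs (S t) \<bullet> y t \<le> grad fs (S T) \<bullet> y t"
      using t y[OF t] by (intro inner_vec_mono_left mono S0 S_le) auto
    with opt[OF t y[OF t]]
    show "v t (y t) \<le> (v t (x t) - grad fs (S t) \<bullet> x t) + grad fs (S T) \<bullet> y t"
      by (simp add: inner_diff_right)
  qed
  also have "\<dots> = W + grad fs (S T) \<bullet> Y"
    by (simp add: W_def Y_def sum.distrib inner_sum_right)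
  finally have "offline_optimum f v T \<le> W + (grad fs (S T) \<bullet> Y - f Y)"
    by (simp add: P Y_def)
  then have "\<alpha> * offline_optimum f v T \<le> \<alpha> * W + \<alpha> * (grad fs (S T) \<bullet> Y - f Y)"
    using \<alpha>(1) by (simp add: mult_left_mono flip: distrib_left)
  also have "\<dots> \<le> W + (fs (S T) - f (S T))"
    using key[OF S0 Y0, of T] mult_right_mono[OF \<alpha>(2) W0] by simp
  finally show ?thesis
    using alg by (simp add: S_def)
qed

section \<open>Nonnegative combinations of monomials\<close>

lemma monomial_fun_nonneg:
  "0 \<le> monomial_fun e u"
  by (auto simp: monomial_fun_def monomial_pow_def intro!: prod_nonneg)

lemma monomial_fun_one [simp]:
  "monomial_fun e 1 = 1"
  by (auto simp: monomial_fun_def monomial_pow_def intro!: prod.neutral)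

lemma monomial_fun_scaleR:
  fixes e u :: "real ^ 'n"
  assumes r: "0 < r" and u: "0 \<le> u"
  shows "monomial_fun e (r *\<^sub>R u) = r powr (\<Sum>i\<in>UNIV. e $ i) * monomial_fun e u"
proof -
  have "monomial_pow (r * u $ i) (e $ i) = r powr (e $ i) * monomial_pow (u $ i) (e $ i)" for i
    using r u by (auto simp: monomial_pow_def less_eq_vec_def powr_mult)
  moreover have "r powr (\<Sum>i\<in>UNIV. e $ i) = (\<Prod>i\<in>UNIV. r powr (e $ i))"
    using r by (intro powr_sum) auto
  ultimately show ?thesis
    by (simp add: monomial_fun_def prod.distrib)
qed

text \<open>
  Euler's identity, read off from the derivative at \<open>r = 1\<close> of \<open>f (r *\<^sub>R u)\<close>, which is an explicit
  sum of powers of \<open>r\<close>. Differentiating along the ray, which stays in the orthant, avoids any question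
  about the partial derivatives of a single monomial on the boundary.
\<close>

lemma grad_inner_self_monomial_sum:
  fixes f :: "real ^ 'n \<Rightarrow> real" and e :: "'k \<Rightarrow> real ^ 'n"
  assumes f: "f differentiable_on {0..}"
    and eq: "\<And>u. 0 \<le> u \<Longrightarrow> f u = (\<Sum>k\<in>A. c k * monomial_fun (e k) u)"
    and u: "0 \<le> u"
  shows "grad f u \<bullet> u = (\<Sum>k\<in>A. c k * (\<Sum>i\<in>UNIV. e k $ i) * monomial_fun (e k) u)"
proof -
  have ray: "(\<lambda>r. r *\<^sub>R u) ` {0<..} \<subseteq> {0..}"
    using u by (auto simp: less_eq_vec_def)
  have "((\<lambda>r. r *\<^sub>R u) has_derivative (\<lambda>r. r *\<^sub>R u)) (at 1 within {0<..})"
    by (auto intro!: derivative_eq_intros)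
  moreover have "(f has_derivative (\<lambda>h. grad f u \<bullet> h))
      (at (1 *\<^sub>R u) within (\<lambda>r. r *\<^sub>R u) ` {0<..})"
    using has_derivative_subset[OF grad_has_derivative[OF f u] ray] by simp
  ultimately have "((\<lambda>r. f (r *\<^sub>R u)) has_derivative (\<lambda>r. grad f u \<bullet> (r *\<^sub>R u)))
      (at 1 within {0<..})"
    by (rule has_derivative_in_compose)
  then have D1: "((\<lambda>r. f (r *\<^sub>R u)) has_real_derivative grad f u \<bullet> u) (at 1)"
    by (simp add: has_field_derivative_def mult.commute[of _ "grad f u \<bullet> u"]
        at_within_open[of _ "{0<..}"])
  have "((\<lambda>r. \<Sum>k\<in>A. c k * (r powr (\<Sum>i\<in>UNIV. e k $ i) * monomial_fun (e k) u))
      has_real_derivative (\<Sum>k\<in>A. c k * (\<Sum>i\<in>UNIV. e k $ i) * monomial_fun (e k) u)) (at 1)"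
    by (auto intro!: derivative_eq_intros sum.cong)
  then have D2: "((\<lambda>r. f (r *\<^sub>R u)) has_real_derivative
      (\<Sum>k\<in>A. c k * (\<Sum>i\<in>UNIV. e k $ i) * monomial_fun (e k) u)) (at 1)"
  proof (rule has_field_derivative_transform_within_open[where S="{0<..}"])
    fix r :: real assume r: "r \<in> {0<..}"
    then have "0 \<le> r *\<^sub>R u"
      using ray by auto
    with r u show "(\<Sum>k\<in>A. c k * (r powr (\<Sum>i\<in>UNIV. e k $ i) * monomial_fun (e k) u))
        = f (r *\<^sub>R u)"
      by (simp add: eq monomial_fun_scaleR)
  qed auto
  from DERIV_unique[OF D1 D2] show ?thesis .
qed

text \<open>
  Along the diagonal, convexity and \<open>f 0 = 0\<close> give \<open>f (r *\<^sub>R 1) \<le> r * f 1\<close> for \<open>r \<le> 1\<close>, whereas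
  a term of degree below one is much larger than \<open>r\<close> near \<open>0\<close>.
\<close>

lemma convex_monomial_sum_degree_ge_1:
  fixes f :: "real ^ 'n \<Rightarrow> real" and e :: "'k \<Rightarrow> real ^ 'n"
  assumes f: "convex_on {0..} f" "f 0 = 0"
    and eq: "\<And>u. 0 \<le> u \<Longrightarrow> f u = (\<Sum>k\<in>A. c k * monomial_fun (e k) u)"
    and A: "finite A" and c: "\<And>k. k \<in> A \<Longrightarrow> 0 < c k" and k: "k \<in> A"
  shows "1 \<le> (\<Sum>i\<in>UNIV. e k $ i)"
proof (rule ccontr)
  define s where "s = (\<Sum>i\<in>UNIV. e k $ i)"
  assume "\<not> ?thesis"
  then have s: "s < 1" by (simp add: s_def)
  have one: "(0 :: real ^ 'n) \<le> 1" by (simp add: less_eq_vec_def)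
  have bound: "c k * r powr s \<le> r * f 1" if r: "0 < r" "r \<le> 1" for r
  proof -
    have r1: "0 \<le> r *\<^sub>R (1 :: real ^ 'n)"
      using r by (simp add: less_eq_vec_def)
    have "c k * r powr s = c k * monomial_fun (e k) (r *\<^sub>R 1)"
      using monomial_fun_scaleR[OF r(1) one, of "e k"] by (simp add: s_def)
    also have "\<dots> \<le> f (r *\<^sub>R 1)"
      unfolding eq[OF r1]
      using c by (intro member_le_sum[OF k _ A]) (auto intro!: mult_nonneg_nonneg monomial_fun_nonneg
            intro: less_imp_le)
    also have "\<dots> \<le> r * f 1"
      using convex_onD[OF f(1), of r 0 1] r one f(2) by simp
    finally show ?thesis .
  qed
  have "c k \<le> f 1 * r powr (1 - s)" if "0 < r" "r \<le> 1" for r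
    using bound[OF that] that by (simp add: powr_diff field_simps)
  then have ev: "eventually (\<lambda>r. c k \<le> f 1 * r powr (1 - s)) (at_right 0)"
    by (intro eventually_at_rightI[of 0 1]) auto
  have "((\<lambda>r. f 1 * r powr (1 - s)) \<longlongrightarrow> f 1 * 0 powr (1 - s)) (at_right 0)"
    using s by (intro tendsto_intros tendsto_powr') (auto simp: eventually_at_filter)
  from tendsto_lowerbound[OF this ev] c[OF k] show False by simp
qed

text \<open>
  With \<open>p = (s - 1) / (\<tau> - 1)\<close>, dividing by \<open>\<rho> powr (s - 1) = \<tau> powr p\<close> turns this into the weighted
  inequality of arithmetic and geometric means \<open>1 powr (1 - p) * (1 / \<tau>) powr p \<le> 1 - p + p / \<tau>\<close>,
  with equality at \<open>s = 1\<close> and at \<open>s = \<tau>\<close>.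
\<close>

lemma scaled_degree_inequality:
  fixes s \<tau> :: real
  assumes \<tau>: "1 < \<tau>" and s: "1 \<le> s" "s \<le> \<tau>" and \<rho>: "\<rho> = \<tau> powr (1 / (\<tau> - 1))"
  shows "\<tau> powr (- \<tau> / (\<tau> - 1)) * ((s - 1) * \<rho> powr s) \<le> \<rho> powr (s - 1) - 1"
proof -
  define p where "p = (s - 1) / (\<tau> - 1)"
  have p: "0 \<le> p" "p \<le> 1"
    using \<tau> s by (auto simp: p_def)
  have s_eq: "s - 1 = p * (\<tau> - 1)"
    using \<tau> by (simp add: p_def)
  have "1 powr (1 - p) * (1 / \<tau>) powr p \<le> (1 - p) * 1 + p * (1 / \<tau>)"
    using p \<tau> by (intro Youngs_inequality_0) auto
  then have "1 \<le> \<tau> powr p * (1 - p + p / \<tau>)"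
    using \<tau> by (simp add: powr_divide divide_simps mult.commute)
  also have "1 - p + p / \<tau> = 1 - (s - 1) / \<tau>"
    using \<tau> by (simp add: s_eq field_simps)
  finally have "\<tau> powr p * ((s - 1) / \<tau>) \<le> \<tau> powr p - 1"
    by (simp add: algebra_simps)
  moreover have "\<rho> powr (s - 1) = \<tau> powr p"
    by (simp add: \<rho> powr_powr p_def)
  moreover have "\<tau> powr (- \<tau> / (\<tau> - 1)) * \<rho> powr s = \<tau> powr p / \<tau>"
  proof -
    have "- \<tau> / (\<tau> - 1) + s / (\<tau> - 1) = p - 1"
      using \<tau> diff_divide_distrib[of "s - 1" "\<tau> - 1" "\<tau> - 1"]
      by (simp add: p_def diff_divide_distrib)
    then show ?thesis
      using \<tau> by (simp add: \<rho> powr_powr powr_diff flip: powr_add)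
  qed
  ultimately show ?thesis
    by (simp add: algebra_simps diff_divide_distrib)
qed

section \<open>The surrogate obtained by scaling\<close>

lemma grad_scaled:
  fixes f fs :: "real ^ 'n \<Rightarrow> real"
  assumes f: "f differentiable_on {0..}" and \<rho>: "0 < \<rho>"
    and eq: "\<And>u. 0 \<le> u \<Longrightarrow> fs u = 1 / \<rho> * f (\<rho> *\<^sub>R u)" and u: "0 \<le> u"
  shows "(fs has_derivative (\<lambda>h. grad f (\<rho> *\<^sub>R u) \<bullet> h)) (at u within {0..})"
    and "grad fs u = grad f (\<rho> *\<^sub>R u)"
proof -
  have \<rho>u: "0 \<le> \<rho> *\<^sub>R w" if "0 \<le> w" for w :: "real ^ 'n"
    using that \<rho> by (simp add: less_eq_vec_def)
  have "((\<lambda>u. \<rho> *\<^sub>R u) has_derivative (\<lambda>h. \<rho> *\<^sub>R h)) (at u within {0..})"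
    by (auto intro!: derivative_eq_intros)
  moreover have "(f has_derivative (\<lambda>h. grad f (\<rho> *\<^sub>R u) \<bullet> h))
      (at (\<rho> *\<^sub>R u) within (\<lambda>u. \<rho> *\<^sub>R u) ` {0..})"
    using \<rho>u by (intro has_derivative_subset[OF grad_has_derivative[OF f \<rho>u[OF u]]]) auto
  ultimately have "((\<lambda>u. f (\<rho> *\<^sub>R u)) has_derivative (\<lambda>h. grad f (\<rho> *\<^sub>R u) \<bullet> (\<rho> *\<^sub>R h)))
      (at u within {0..})"
    by (rule has_derivative_in_compose)
  then have "((\<lambda>u. 1 / \<rho> * f (\<rho> *\<^sub>R u)) has_derivative
      (\<lambda>h. 1 / \<rho> * (grad f (\<rho> *\<^sub>R u) \<bullet> (\<rho> *\<^sub>R h)))) (at u within {0..})"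
    by (rule has_derivative_mult_right)
  then show D: "(fs has_derivative (\<lambda>h. grad f (\<rho> *\<^sub>R u) \<bullet> h)) (at u within {0..})"
    using \<rho> u by (auto simp: eq intro: has_derivative_transform)
  show "grad fs u = grad f (\<rho> *\<^sub>R u)"
    using D u by (rule grad_eqI)
qed

lemma convex_on_scaled:
  fixes f fs :: "real ^ 'n \<Rightarrow> real"
  assumes f: "convex_on {0..} f" and \<rho>: "0 < \<rho>"
    and eq: "\<And>u. 0 \<le> u \<Longrightarrow> fs u = 1 / \<rho> * f (\<rho> *\<^sub>R u)"
  shows "convex_on {0..} fs"
proof (rule convex_onI)
  fix t :: real and u w :: "real ^ 'n"
  assume t: "0 < t" "t < 1" and uw: "u \<in> {0..}" "w \<in> {0..}"
  have nn: "0 \<le> \<rho> *\<^sub>R u" "0 \<le> \<rho> *\<^sub>R w" "0 \<le> (1 - t) *\<^sub>R u + t *\<^sub>R w"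
    using uw t \<rho> by (auto simp: less_eq_vec_def)
  have "f (\<rho> *\<^sub>R ((1 - t) *\<^sub>R u + t *\<^sub>R w)) = f ((1 - t) *\<^sub>R (\<rho> *\<^sub>R u) + t *\<^sub>R (\<rho> *\<^sub>R w))"
    by (simp add: algebra_simps)
  also have "\<dots> \<le> (1 - t) * f (\<rho> *\<^sub>R u) + t * f (\<rho> *\<^sub>R w)"
    using nn t by (intro convex_onD[OF f]) auto
  finally show "fs ((1 - t) *\<^sub>R u + t *\<^sub>R w) \<le> (1 - t) * fs u + t * fs w"
    using nn uw \<rho> by (simp add: eq divide_simps)
qed (rule convex_on_imp_convex[OF f])

text \<open>
  Tangency at \<open>\<rho> *\<^sub>R u\<close> shows that \<open>w = \<rho> *\<^sub>R u\<close> is the best response to the price at \<open>u\<close>. There both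
  sides are combinations of the monomials at \<open>u\<close>, and they are compared degree by degree.
\<close>

lemma scaled_monomial_sum_criterion:
  fixes f :: "real ^ 'n \<Rightarrow> real" and e :: "'k \<Rightarrow> real ^ 'n"
  assumes f: "convex_on {0..} f" "f differentiable_on {0..}" "f 0 = 0"
    and eq: "\<And>u. 0 \<le> u \<Longrightarrow> f u = (\<Sum>k\<in>A. c k * monomial_fun (e k) u)"
    and A: "finite A" and c: "\<And>k. k \<in> A \<Longrightarrow> 0 < c k"
    and deg: "\<And>k. k \<in> A \<Longrightarrow> (\<Sum>i\<in>UNIV. e k $ i) \<le> \<tau>"
    and \<tau>: "1 < \<tau>" and \<rho>: "\<rho> = \<tau> powr (1 / (\<tau> - 1))"
    and u: "0 \<le> u" and w: "0 \<le> w"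
  shows "\<tau> powr (- \<tau> / (\<tau> - 1)) * (grad f (\<rho> *\<^sub>R u) \<bullet> w - f w) \<le> 1 / \<rho> * f (\<rho> *\<^sub>R u) - f u"
    (is "?\<alpha> * _ \<le> _")
proof -
  define d where "d = (\<lambda>k. \<Sum>i\<in>UNIV. e k $ i)"
  have \<rho>0: "0 < \<rho>"
    using \<tau> by (simp add: \<rho>)
  have \<rho>u: "0 \<le> \<rho> *\<^sub>R u"
    using u \<rho>0 by (simp add: less_eq_vec_def)
  have "?\<alpha> * (grad f (\<rho> *\<^sub>R u) \<bullet> w - f w)
      \<le> ?\<alpha> * (grad f (\<rho> *\<^sub>R u) \<bullet> (\<rho> *\<^sub>R u) - f (\<rho> *\<^sub>R u))"
    using convex_on_ge_grad[OF f(1,2) \<rho>u w]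
    by (intro mult_left_mono) (auto simp: inner_diff_right)
  also have "\<dots> = ?\<alpha> * (\<Sum>k\<in>A. c k * (d k - 1) * monomial_fun (e k) (\<rho> *\<^sub>R u))"
  proof -
    have "grad f (\<rho> *\<^sub>R u) \<bullet> (\<rho> *\<^sub>R u) = (\<Sum>k\<in>A. c k * d k * monomial_fun (e k) (\<rho> *\<^sub>R u))"
      unfolding d_def by (rule grad_inner_self_monomial_sum[OF f(2) eq \<rho>u])
    then show ?thesis
      unfolding eq[OF \<rho>u] by (simp only: left_diff_distrib right_diff_distrib sum_subtractf mult_1_right)
  qed
  also have "\<dots> = (\<Sum>k\<in>A. (?\<alpha> * ((d k - 1) * \<rho> powr d k)) * (c k * monomial_fun (e k) u))"
    unfolding monomial_fun_scaleR[OF \<rho>0 u] by (simp add: sum_distrib_left d_def mult_ac)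
  also have "\<dots> \<le> (\<Sum>k\<in>A. (\<rho> powr (d k - 1) - 1) * (c k * monomial_fun (e k) u))"
  proof (rule sum_mono)
    fix k assume k: "k \<in> A"
    have "1 \<le> d k" "d k \<le> \<tau>"
      using convex_monomial_sum_degree_ge_1[OF f(1,3) eq A c k] deg[OF k] by (auto simp: d_def)
    from scaled_degree_inequality[OF \<tau> this \<rho>]
    show "(?\<alpha> * ((d k - 1) * \<rho> powr d k)) * (c k * monomial_fun (e k) u)
        \<le> (\<rho> powr (d k - 1) - 1) * (c k * monomial_fun (e k) u)"
      using c[OF k] by (intro mult_right_mono mult_nonneg_nonneg monomial_fun_nonneg) auto
  qed
  also have "\<dots> = 1 / \<rho> * f (\<rho> *\<^sub>R u) - f u"
    unfolding eq[OF \<rho>u] eq[OF u] monomial_fun_scaleR[OF \<rho>0 u]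
    using \<rho>0 by (simp add: sum_distrib_left d_def powr_diff algebra_simps sum_subtractf)
  finally show ?thesis .
qed

theorem theorem5p1:
  fixes K T :: nat
    and c :: "nat \<Rightarrow> real"
    and e :: "nat \<Rightarrow> real ^ 'n"
    and fK fs :: "real ^ 'n \<Rightarrow> real"
    and \<tau> \<rho> :: real
    and v :: "nat \<Rightarrow> real ^ 'n \<Rightarrow> real"
    and l z x :: "nat \<Rightarrow> real ^ 'n"
  assumes "1 \<le> T" and "1 \<le> K"
    and "\<And>k. k \<in> {1..K} \<Longrightarrow> 0 < c k"
    and "\<And>k i. k \<in> {1..K} \<Longrightarrow> 0 \<le> e k $ i"
    and "\<And>u. 0 \<le> u \<Longrightarrow> fK u = (\<Sum>k=1..K. c k * monomial_fun (e k) u)"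
    and "procurement_cost fK"
    and "\<tau> = Max ((\<lambda>k. \<Sum>i\<in>UNIV. e k $ i) ` {1..K})"
    and "2 \<le> \<tau>"
    and "\<rho> = \<tau> powr (1 / (\<tau> - 1))"
    and "\<And>u. 0 \<le> u \<Longrightarrow> fs u = 1 / \<rho> * fK (\<rho> *\<^sub>R u)"
    and "\<And>t. t \<in> {1..T} \<Longrightarrow> payment_function (v t)"
    and "simultaneous_update fs v T l z x"
  shows "(\<Sum>t=1..T. v t (x t)) - fK (\<Sum>t=1..T. x t)
           \<ge> \<tau> powr (- \<tau> / (\<tau> - 1)) * offline_optimum fK v T"
proof -
  have f: "convex_on {0..} fK" "fK differentiable_on {0..}" "fK 0 = 0"
    and f_mono: "\<And>u w. 0 \<le> w \<Longrightarrow> w \<le> u \<Longrightarrow> grad fK w \<le> grad fK u"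
    using \<open>procurement_cost fK\<close> unfolding procurement_cost_def by (auto intro: order_trans)
  have \<rho>0: "0 < \<rho>"
    using \<open>2 \<le> \<tau>\<close> by (simp add: assms(9))
  have grad_fs: "grad fs u = grad fK (\<rho> *\<^sub>R u)" if "0 \<le> u" for u
    using grad_scaled(2)[OF f(2) \<rho>0 assms(10) that] .
  show ?thesis
  proof (rule simultaneous_update_competitive[OF \<open>procurement_cost fK\<close> _ _ _ _ assms(11,12)])
    show "convex_on {0..} fs"
      by (rule convex_on_scaled[OF f(1) \<rho>0 assms(10)])
    show "fs differentiable_on {0..}"
      using grad_scaled(1)[OF f(2) \<rho>0 assms(10)]
      by (auto simp: differentiable_on_def differentiable_def)
    show "fs 0 = 0"
      using assms(10)[of 0] f(3) by simp
    show "grad fs w \<le> grad fs u" if wu: "0 \<le> w" "w \<le> u" for u w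
    proof -
      have "0 \<le> \<rho> *\<^sub>R w" "\<rho> *\<^sub>R w \<le> \<rho> *\<^sub>R u"
        using wu \<rho>0 by (auto simp: less_eq_vec_def)
      with wu show ?thesis
        using f_mono by (simp add: grad_fs order_trans[OF wu])
    qed
    show "0 \<le> \<tau> powr (- \<tau> / (\<tau> - 1))"
      by simp
    show "\<tau> powr (- \<tau> / (\<tau> - 1)) \<le> 1"
      using \<open>2 \<le> \<tau>\<close> powr_mono[of "- \<tau> / (\<tau> - 1)" 0 \<tau>] by simp
    show "\<tau> powr (- \<tau> / (\<tau> - 1)) * (grad fs u \<bullet> w - fK w) \<le> fs u - fK u"
      if uw: "0 \<le> u" "0 \<le> w" for u w
    proof -
      have "(\<Sum>i\<in>UNIV. e k $ i) \<le> \<tau>" if "k \<in> {1..K}" for k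
        unfolding assms(7) using that by (intro Max_ge) auto
      from scaled_monomial_sum_criterion[OF f assms(5) _ assms(3) this _ assms(9) uw]
      show ?thesis
        using \<open>2 \<le> \<tau>\<close> uw by (simp add: grad_fs assms(10))
    qed
  qed
qed

end
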